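(* Let $A\subset\mathbb{Z}_+$, let $\mathbf{E}$ be a URI-set, and let $\mathbf{E}_n:=\mathbf{E}\cap\{1,\ldots,n\}$ for $n\ge1$. Then, almost surely, $$\frac{1}{|\mathbf{E}_n|}\sum_{j=1}^n \mathbf{1}_{A}(j)\,\mathbf{1}_{\mathbf{E}}(j) - \frac{1}{\ln n}\sum_{j=1}^n \frac{\mathbf{1}_{A}(j)}{j} \longrightarrow 0\quad\text{as } n\to\infty.$$ In particular, for every real $\alpha$, $A$ has URI-density $\alpha$ if and only if $A$ has log-density $\alpha$.
   Context: $\mathbb{Z}_+$ denotes the set of positive integers, $\mathbf{1}_S$ the indicator function of a set $S$, and $|\cdot|$ cardinality. A URI-set is a random set $\mathbf{E}$ of positive integers such that each integer $n\ge1$ belongs to $\mathbf{E}$ with probability $1/n$, the events $(n\in\mathbf{E})$, $n\ge1$, being independent. Almost surely $\mathbf{E}$ is infinite, and its ordered elements are denoted $N_1=1<N_2<\cdots<N_k<\cdots$. A set $A\subset\mathbb{Z}_+$ has URI-density $\alpha$ if, almost surely, $\frac1n\sum_{k=1}^n\mathbf{1}_A(N_k)\to\alpha$ as $n\to\infty$. A set $A\subset\mathbb{Z}_+$ has log-density $\alpha$ if $\frac{1}{\ln n}\sum_{j=1}^n\frac1j\mathbf{1}_A(j)\to\alpha$ as $n\to\infty$. *)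

theory Defs
  imports "HOL-Probability.Probability"
begin

text \<open>
  A random set of positive integers is a map from the probability space \<open>M\<close> to sets of naturals;
  independence over the index set \<open>{1..}\<close> includes measurability of the events \<open>n \<in> E\<close>.
\<close>

locale uri_set = prob_space M for M :: "'w measure" +
  fixes E :: "'w \<Rightarrow> nat set"
  assumes positive: "\<And>\<omega>. \<omega> \<in> space M \<Longrightarrow> E \<omega> \<subseteq> {1..}"
    and indep: "indep_events (\<lambda>n. {\<omega> \<in> space M. n \<in> E \<omega>}) {1..}"
    and prob_mem: "\<And>n. 1 \<le> n \<Longrightarrow> prob {\<omega> \<in> space M. n \<in> E \<omega>} = 1 / real n"

text \<open>
  The \<open>k\<close>-th smallest element of \<open>S\<close> for \<open>k \<ge> 1\<close>, whereas \<open>enumerate\<close> counts from 0. It is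
  meaningful when \<open>S\<close> is infinite, which holds almost surely for a URI-set.
\<close>

definition ordered_element :: "nat set \<Rightarrow> nat \<Rightarrow> nat" where
  "ordered_element S k = enumerate S (k - 1)"

text \<open>
  Whether \<open>A\<close> has URI-density \<open>\<alpha>\<close> depends only on the law of the URI-set, but \<open>almost surely\<close>
  refers to the probability space carrying it, so \<open>M\<close> and \<open>E\<close> are arguments.
\<close>

definition has_uri_density :: "'w measure \<Rightarrow> ('w \<Rightarrow> nat set) \<Rightarrow> nat set \<Rightarrow> real \<Rightarrow> bool" where
  "has_uri_density M E A \<alpha> \<longleftrightarrow>
    (AE \<omega> in M. (\<lambda>n. 1 / real n * (\<Sum>k=1..n. indicat_real A (ordered_element (E \<omega>) k)))
                  \<longlonglongrightarrow> \<alpha>)"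

definition has_log_density :: "nat set \<Rightarrow> real \<Rightarrow> bool" where
  "has_log_density A \<alpha> \<longleftrightarrow>
    (\<lambda>n. 1 / ln (real n) * (\<Sum>j=1..n. 1 / real j * indicat_real A j)) \<longlonglongrightarrow> \<alpha>"

end

theory Submission
  imports Defs "HOL-Real_Asymp.Real_Asymp"
begin

text \<open>
  Write \<open>S\<^sub>n(A)\<close> for the number of \<open>j \<le> n\<close> in \<open>A \<inter> E\<close> and \<open>m\<^sub>n(A)\<close> for its mean, the sum of
  \<open>1/j\<close> over the \<open>j \<le> n\<close> in \<open>A\<close>. As \<open>S\<^sub>n(A)\<close> is a sum of independent indicators, its variance is at
  most its mean, hence at most the harmonic number \<open>H\<^sub>n\<close>. A strong law follows from this bound alone:
  almost surely \<open>(S\<^sub>n(A) - m\<^sub>n(A)) / H\<^sub>n \<longlonglongrightarrow> 0\<close>.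

  Indeed, let \<open>N k\<close> be the first index at which \<open>H\<close> reaches \<open>k\<^sup>2\<close>. Along \<open>N k\<close> the normalised
  deviations have second moments of order \<open>1/k\<^sup>2\<close>, which is summable, so they vanish in the limit
  almost surely (\<open>AE_tendsto_zero_if_summable_second_moments\<close>). Between \<open>N k\<close> and \<open>N (k + 1)\<close> both
  \<open>S\<close> and \<open>m\<close> are monotone and \<open>H\<close> grows only by \<open>O(k)\<close>, which is negligible against \<open>k\<^sup>2\<close>
  (\<open>deviation_negligible_if_negligible_along_squares\<close>). The argument rests on pairwise independence
  and on the divergence of the sum of the probabilities, and the strong law is stated at that
  generality (\<open>strong_law_pairwise_indep_events\<close>).

  The harmonic numbers are asymptotic to \<open>ln n\<close>. Taking for \<open>A\<close> all positive integers shows that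
  \<open>card (E \<inter> {1..n})\<close> is asymptotic to \<open>ln n\<close>, which allows both normalisations to be exchanged and
  gives the first claim. For the equivalence, the averages in the definition of URI-density, taken at
  the index \<open>card (E \<inter> {1..n})\<close>, are exactly the quotients in the first claim. This index is
  unbounded and takes every value, so both sequences have the same limits on almost every
  outcome. Log-density, however, does not depend on the outcome, so a single good outcome
  transfers the limit back.
\<close>

section \<open>A strong law for pairwise independent events\<close>

text \<open>
  The sum of the squares has a finite integral, so it is finite almost everywhere, and then its terms
  tend to zero.
\<close>

lemma AE_tendsto_zero_if_summable_second_moments:
  fixes Z :: "nat \<Rightarrow> 'a \<Rightarrow> real"
  assumes meas: "\<And>k. Z k \<in> borel_measurable M"
    and int: "\<And>k. integrable M (\<lambda>x. (Z k x)\<^sup>2)"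
    and sum: "summable (\<lambda>k. \<integral>x. (Z k x)\<^sup>2 \<partial>M)"
  shows "AE x in M. (\<lambda>k. Z k x) \<longlonglongrightarrow> 0"
proof -
  note [measurable] = meas
  have "(\<integral>\<^sup>+x. (\<Sum>k. ennreal ((Z k x)\<^sup>2)) \<partial>M) = (\<Sum>k. \<integral>\<^sup>+x. ennreal ((Z k x)\<^sup>2) \<partial>M)"
    by (rule nn_integral_suminf) measurable
  also have "\<dots> = (\<Sum>k. ennreal (\<integral>x. (Z k x)\<^sup>2 \<partial>M))"
    by (simp add: nn_integral_eq_integral int)
  also have "\<dots> \<noteq> \<infinity>"
    unfolding infinity_ennreal_def by (intro ennreal_suminf_neq_top sum integral_nonneg_AE) simp
  finally have "AE x in M. (\<Sum>k. ennreal ((Z k x)\<^sup>2)) \<noteq> \<infinity>"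
    by (intro nn_integral_noteq_infinite) measurable
  then show ?thesis
  proof eventually_elim
    case (elim x)
    then have "summable (\<lambda>k. (Z k x)\<^sup>2)"
      using summable_iff_suminf_neq_top[of "\<lambda>k. (Z k x)\<^sup>2"] by auto
    then have "(\<lambda>k. (Z k x)\<^sup>2) \<longlonglongrightarrow> 0"
      by (rule summable_LIMSEQ_zero)
    then show ?case
      using tendsto_real_sqrt by (force simp: tendsto_rabs_zero_iff)
  qed
qed

text \<open>
  Pairwise independence makes the covariances vanish, and the variance of an indicator is
  \<open>p - p\<^sup>2 \<le> p\<close>.
\<close>

lemma (in prob_space) second_moment_indicator_sum:
  fixes B :: "nat \<Rightarrow> 'a set"
  assumes fin: "finite J"
    and ev: "\<And>i. i \<in> J \<Longrightarrow> B i \<in> events"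
    and indep: "\<And>i j. i \<in> J \<Longrightarrow> j \<in> J \<Longrightarrow> i \<noteq> j \<Longrightarrow> prob (B i \<inter> B j) = prob (B i) * prob (B j)"
  shows "integrable M (\<lambda>x. ((\<Sum>j\<in>J. indicat_real (B j) x) - (\<Sum>j\<in>J. prob (B j)))\<^sup>2)"
    and "expectation (\<lambda>x. ((\<Sum>j\<in>J. indicat_real (B j) x) - (\<Sum>j\<in>J. prob (B j)))\<^sup>2)
           \<le> (\<Sum>j\<in>J. prob (B j))"
proof -
  define V where "V i j x = (indicat_real (B i) x - prob (B i)) * (indicat_real (B j) x - prob (B j))"
    for i j x
  have V_alt: "V i j = (\<lambda>x. indicat_real (B i \<inter> B j) x - prob (B j) * indicat_real (B i) x
      - prob (B i) * indicat_real (B j) x + prob (B i) * prob (B j))" for i j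
    by (auto simp: V_def fun_eq_iff indicator_def algebra_simps)
  have sq: "(\<lambda>x. ((\<Sum>j\<in>J. indicat_real (B j) x) - (\<Sum>j\<in>J. prob (B j)))\<^sup>2)
      = (\<lambda>x. \<Sum>i\<in>J. \<Sum>j\<in>J. V i j x)"
    by (simp add: fun_eq_iff power2_eq_square V_def sum_subtractf[symmetric] sum_product)
  have int1: "integrable M (indicat_real (B i))" if "i \<in> J" for i
    using ev[OF that] by (simp add: integrable_indicator_iff less_top[symmetric])
  have int2: "integrable M (indicat_real (B i \<inter> B j))" if "i \<in> J" "j \<in> J" for i j
    using ev[OF that(1)] ev[OF that(2)] by (simp add: integrable_indicator_iff less_top[symmetric] sets.Int)
  have intV: "integrable M (V i j)" if "i \<in> J" "j \<in> J" for i j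
    unfolding V_alt using int1 int2 that by auto
  have expV: "expectation (V i j) = prob (B i \<inter> B j) - prob (B i) * prob (B j)"
    if "i \<in> J" "j \<in> J" for i j
  proof -
    have "B i \<subseteq> space M" "B j \<subseteq> space M" "B i \<inter> B j \<subseteq> space M"
      using ev that sets.sets_into_space by blast+
    then show ?thesis
      unfolding V_alt using int1 int2 that by (simp add: prob_space Int_absorb2)
  qed
  have "expectation (\<lambda>x. \<Sum>i\<in>J. \<Sum>j\<in>J. V i j x)
      = (\<Sum>i\<in>J. \<Sum>j\<in>J. prob (B i \<inter> B j) - prob (B i) * prob (B j))"
    using intV expV by (simp add: Bochner_Integration.integral_sum)
  also have "\<dots> = (\<Sum>i\<in>J. \<Sum>j\<in>J. if j = i then prob (B i) - (prob (B i))\<^sup>2 else 0)"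
    using indep by (intro sum.cong refl) (auto simp: power2_eq_square)
  also have "\<dots> \<le> (\<Sum>i\<in>J. prob (B i))"
    using fin by (simp add: sum_mono)
  finally show "expectation (\<lambda>x. ((\<Sum>j\<in>J. indicat_real (B j) x) - (\<Sum>j\<in>J. prob (B j)))\<^sup>2)
      \<le> (\<Sum>j\<in>J. prob (B j))"
    by (simp add: sq)
  show "integrable M (\<lambda>x. ((\<Sum>j\<in>J. indicat_real (B j) x) - (\<Sum>j\<in>J. prob (B j)))\<^sup>2)"
    unfolding sq using intV by auto
qed

text \<open>
  The squares are the right scale: coarse enough for the second moments along them to be summable, yet
  consecutive ones differ by \<open>O(k)\<close>, which is \<open>o(k\<^sup>2)\<close>. When the steps of
  \<open>h\<close> are at most 1, it overshoots a square by at most 1, so the values \<open>h (N k)\<close> inherit both properties.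
\<close>

definition first_reach :: "(nat \<Rightarrow> real) \<Rightarrow> nat \<Rightarrow> nat" where
  "first_reach h k = (LEAST n. (real k)\<^sup>2 \<le> h n)"

lemma first_reach_bounds:
  fixes h :: "nat \<Rightarrow> real"
  assumes inf: "filterlim h at_top sequentially"
    and step: "\<And>n. h (Suc n) \<le> h n + 1" and h0: "h 0 \<le> 1"
  shows "(real k)\<^sup>2 \<le> h (first_reach h k)" and "h (first_reach h k) \<le> (real k)\<^sup>2 + 1"
    and "(real k)\<^sup>2 \<le> h n \<Longrightarrow> first_reach h k \<le> n"
proof -
  have "\<exists>n. (real k)\<^sup>2 \<le> h n"
    using inf by (metis eventually_sequentially filterlim_at_top order_refl)
  then show "(real k)\<^sup>2 \<le> h (first_reach h k)"
    unfolding first_reach_def by (rule LeastI_ex)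
  show "first_reach h k \<le> n" if "(real k)\<^sup>2 \<le> h n" for n
    unfolding first_reach_def using that by (rule Least_le)
  then have *: "\<not> (real k)\<^sup>2 \<le> h n" if "n < first_reach h k" for n
    using that by (meson not_le)
  show "h (first_reach h k) \<le> (real k)\<^sup>2 + 1"
  proof (cases "first_reach h k")
    case 0
    then show ?thesis
      using h0 by (simp add: add_increasing)
  next
    case (Suc n)
    then show ?thesis
      using *[of n] step[of n] by simp
  qed
qed

text \<open>
  If \<open>N\<close> and \<open>N'\<close> are consecutive indices on the scale of squares and \<open>N \<le> n \<le> N'\<close>, monotonicity
  squeezes \<open>s n - m n\<close> between \<open>s N - m N'\<close> and \<open>s N' - m N\<close>.
\<close>

lemma deviation_negligible_if_negligible_along_squares:
  fixes s m h :: "nat \<Rightarrow> real"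
  assumes s: "mono s" and m: "mono m"
    and incr: "\<And>i j. i \<le> j \<Longrightarrow> m j - m i \<le> h j - h i"
    and inf: "filterlim h at_top sequentially"
    and step: "\<And>n. h (Suc n) \<le> h n + 1" and h0: "h 0 \<le> 1"
    and sub: "(\<lambda>k. (s (first_reach h k) - m (first_reach h k)) / (real k)\<^sup>2) \<longlonglongrightarrow> 0"
  shows "(\<lambda>n. (s n - m n) / h n) \<longlonglongrightarrow> 0"
proof -
  note N = first_reach_bounds[OF inf step h0]
  define N where "N = first_reach h"
  define d where "d k = \<bar>s (N k) - m (N k)\<bar> / (real k)\<^sup>2" for k
  define b where "b k = d k + 4 * d (Suc k) + (2 * real k + 2) / (real k)\<^sup>2" for k
  define r where "r n = nat \<lfloor>sqrt (h n)\<rfloor>" for n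
  have h_mono: "h i \<le> h j" if "i \<le> j" for i j
    using incr[OF that] monoD[OF m that] by linarith
  have "d \<longlonglongrightarrow> 0"
    using tendsto_rabs_zero[OF sub] by (simp add: d_def[abs_def] N_def abs_divide)
  moreover from this have "(\<lambda>k. d (Suc k)) \<longlonglongrightarrow> 0"
    by (rule LIMSEQ_Suc)
  moreover have "(\<lambda>k. (2 * real k + 2) / (real k)\<^sup>2) \<longlonglongrightarrow> 0"
    by real_asymp
  ultimately have "b \<longlonglongrightarrow> 0 + 4 * 0 + 0"
    unfolding b_def[abs_def] by (intro tendsto_intros)
  moreover have "filterlim r at_top sequentially"
    unfolding r_def
    by (intro filterlim_compose[OF filterlim_nat_sequentially]
        filterlim_compose[OF filterlim_floor_sequentially] filterlim_compose[OF sqrt_at_top] inf)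
  ultimately have lim: "(\<lambda>n. b (r n)) \<longlonglongrightarrow> 0"
    by (simp add: filterlim_compose)
  have "eventually (\<lambda>n. 1 \<le> h n) sequentially"
    using inf by (simp add: filterlim_at_top)
  then have "eventually (\<lambda>n. norm ((s n - m n) / h n) \<le> b (r n)) sequentially"
  proof eventually_elim
    case (elim n)
    define k where "k = r n"
    have k1: "1 \<le> real k" and kle: "real k \<le> sqrt (h n)"
      using elim by (auto simp: k_def r_def le_nat_iff le_floor_iff)
    have "real k = of_int \<lfloor>sqrt (h n)\<rfloor>"
      using elim by (simp add: k_def r_def)
    then have klt: "sqrt (h n) < real (Suc k)"
      by linarith
    have k_le: "(real k)\<^sup>2 \<le> h n"
      using power_mono[OF kle, of 2] elim by simp
    have k_lt: "h n < (real (Suc k))\<^sup>2"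
      using power_strict_mono[OF klt, of 2] elim by simp
    have Nn: "N k \<le> n"
      unfolding N_def by (rule N(3)[OF k_le])
    have nN: "n \<le> N (Suc k)"
    proof (rule ccontr)
      assume "\<not> n \<le> N (Suc k)"
      then have "h (N (Suc k)) \<le> h n"
        by (intro h_mono) simp
      then show False
        using N(1)[of "Suc k"] k_lt by (simp add: N_def)
    qed
    let ?D = "\<lambda>i. s i - m i"
    have "m (N (Suc k)) - m (N k) \<le> h (N (Suc k)) - h (N k)"
      using Nn nN by (intro incr) simp
    also have "\<dots> \<le> ((real (Suc k))\<^sup>2 + 1) - (real k)\<^sup>2"
      using N(2)[of "Suc k"] N(1)[of k] by (simp add: N_def)
    also have "\<dots> = 2 * real k + 2"
      by (simp add: power2_eq_square algebra_simps)
    finally have gap: "m (N (Suc k)) - m (N k) \<le> 2 * real k + 2" .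
    have "\<bar>?D n\<bar> \<le> \<bar>?D (N k)\<bar> + \<bar>?D (N (Suc k))\<bar> + (2 * real k + 2)"
      using gap monoD[OF s Nn] monoD[OF s nN] monoD[OF m Nn] monoD[OF m nN] by linarith
    then have "\<bar>?D n\<bar> / h n \<le> (\<bar>?D (N k)\<bar> + \<bar>?D (N (Suc k))\<bar> + (2 * real k + 2)) / (real k)\<^sup>2"
      using k_le k1 elim by (intro frac_le) auto
    also have "\<dots> = d k + \<bar>?D (N (Suc k))\<bar> / (real k)\<^sup>2 + (2 * real k + 2) / (real k)\<^sup>2"
      by (simp add: d_def add_divide_distrib)
    \<comment> \<open>Renormalising the right endpoint by its own square costs at most \<open>((k + 1) / k)\<^sup>2 \<le> 4\<close>.\<close>
    also have "\<bar>?D (N (Suc k))\<bar> / (real k)\<^sup>2 \<le> 4 * d (Suc k)"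
    proof -
      have "(real (Suc k))\<^sup>2 \<le> (2 * real k)\<^sup>2"
        using k1 by (intro power_mono) auto
      then have "\<bar>?D (N (Suc k))\<bar> / (real k)\<^sup>2 \<le> \<bar>?D (N (Suc k))\<bar> / ((real (Suc k))\<^sup>2 / 4)"
        using k1 by (intro divide_left_mono) (auto simp: power_mult_distrib)
      then show ?thesis
        by (simp add: d_def mult.commute)
    qed
    finally show ?case
      using elim by (simp add: b_def k_def)
  qed
  then show ?thesis
    by (rule Lim_null_comparison) (rule lim)
qed

text \<open>
  The sub-family \<open>A\<close> is measured against the total mass of the whole family \<open>I\<close>, so the statement is
  informative even if the probabilities have a finite sum over \<open>A\<close>.
\<close>

theorem (in prob_space) strong_law_pairwise_indep_events:
  fixes B :: "nat \<Rightarrow> 'a set"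
  assumes ev: "\<And>i. i \<in> I \<Longrightarrow> B i \<in> events"
    and indep: "\<And>i j. i \<in> I \<Longrightarrow> j \<in> I \<Longrightarrow> i \<noteq> j \<Longrightarrow> prob (B i \<inter> B j) = prob (B i) * prob (B j)"
    and diverges: "filterlim (\<lambda>n. \<Sum>j\<in>I \<inter> {..n}. prob (B j)) at_top sequentially"
    and AI: "A \<subseteq> I"
  shows "AE \<omega> in M. (\<lambda>n. ((\<Sum>j\<in>A \<inter> {..n}. indicat_real (B j) \<omega>) - (\<Sum>j\<in>A \<inter> {..n}. prob (B j)))
           / (\<Sum>j\<in>I \<inter> {..n}. prob (B j))) \<longlonglongrightarrow> 0"
proof -
  define h where "h n = (\<Sum>j\<in>I \<inter> {..n}. prob (B j))" for n
  define m where "m n = (\<Sum>j\<in>A \<inter> {..n}. prob (B j))" for n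
  define s where "s n \<omega> = (\<Sum>j\<in>A \<inter> {..n}. indicat_real (B j) \<omega>)" for n \<omega>
  define N where "N = first_reach h"
  have inf: "filterlim h at_top sequentially"
    using diverges by (simp add: h_def[abs_def])
  have step: "h (Suc n) \<le> h n + 1" for n
    by (auto simp: h_def atMost_Suc Int_insert_right)
  have h0: "h 0 \<le> 1"
    by (auto simp: h_def Int_insert_right)
  note N = first_reach_bounds[OF inf step h0]
  have m_le_h: "m n \<le> h n" for n
    unfolding m_def h_def using AI by (intro sum_mono2) auto
  have incr: "m j - m i \<le> h j - h i" if "i \<le> j" for i j
  proof -
    have split: "(\<Sum>l\<in>C \<inter> {..j}. prob (B l)) - (\<Sum>l\<in>C \<inter> {..i}. prob (B l))
        = (\<Sum>l\<in>C \<inter> {i<..j}. prob (B l))" for C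
    proof -
      have "C \<inter> {..j} = (C \<inter> {..i}) \<union> (C \<inter> {i<..j})"
        using that by auto
      then show ?thesis
        by (subst \<open>C \<inter> {..j} = _\<close>, subst sum.union_disjoint) auto
    qed
    show ?thesis
      unfolding m_def h_def split using AI by (intro sum_mono2) auto
  qed
  have moments: "integrable M (\<lambda>\<omega>. (s n \<omega> - m n)\<^sup>2)" "expectation (\<lambda>\<omega>. (s n \<omega> - m n)\<^sup>2) \<le> m n" for n
    unfolding s_def m_def using AI ev indep
    by (intro second_moment_indicator_sum; blast)+
  have s_meas[measurable]: "s n \<in> borel_measurable M" for n
    unfolding s_def[abs_def] using AI ev by (intro borel_measurable_sum borel_measurable_indicator) auto
  have "AE \<omega> in M. (\<lambda>k. (s (N k) \<omega> - m (N k)) / (real k)\<^sup>2) \<longlonglongrightarrow> 0"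
  proof (rule AE_tendsto_zero_if_summable_second_moments)
    show "(\<lambda>\<omega>. (s (N k) \<omega> - m (N k)) / (real k)\<^sup>2) \<in> borel_measurable M" for k
      by measurable
    show "integrable M (\<lambda>\<omega>. ((s (N k) \<omega> - m (N k)) / (real k)\<^sup>2)\<^sup>2)" for k
      using moments(1)[of "N k"] by (simp add: power_divide)
    \<comment> \<open>The variance at \<open>N k\<close> is at most \<open>k\<^sup>2 + 1 \<le> 2 * k\<^sup>2\<close>; for \<open>k = 0\<close> both sides are 0, as \<open>x / 0 = 0\<close>.\<close>
    have bound: "(\<integral>\<omega>. ((s (N k) \<omega> - m (N k)) / (real k)\<^sup>2)\<^sup>2 \<partial>M) \<le> 2 * inverse ((real k)\<^sup>2)" for k
    proof (cases "k = 0")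
      case False
      then have k: "1 \<le> (real k)\<^sup>2"
        by (simp add: Suc_leI)
      have "(\<integral>\<omega>. ((s (N k) \<omega> - m (N k)) / (real k)\<^sup>2)\<^sup>2 \<partial>M)
          = expectation (\<lambda>\<omega>. (s (N k) \<omega> - m (N k))\<^sup>2) / ((real k)\<^sup>2)\<^sup>2"
        by (simp add: power_divide)
      also have "\<dots> \<le> (2 * (real k)\<^sup>2) / ((real k)\<^sup>2)\<^sup>2"
        using moments(2)[of "N k"] m_le_h[of "N k"] N(2)[of k] k
        by (intro divide_right_mono) (auto simp: N_def)
      also have "\<dots> = 2 * inverse ((real k)\<^sup>2)"
        using False by (simp add: field_simps power2_eq_square)
      finally show ?thesis .
    qed simp
    show "summable (\<lambda>k. \<integral>\<omega>. ((s (N k) \<omega> - m (N k)) / (real k)\<^sup>2)\<^sup>2 \<partial>M)"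
    proof (rule summable_comparison_test')
      show "summable (\<lambda>k. 2 * inverse ((real k)\<^sup>2))"
        by (intro summable_mult inverse_power_summable) simp
      show "norm (\<integral>\<omega>. ((s (N k) \<omega> - m (N k)) / (real k)\<^sup>2)\<^sup>2 \<partial>M) \<le> 2 * inverse ((real k)\<^sup>2)"
        if "0 \<le> k" for k
        using bound[of k] by simp
    qed
  qed
  then have "AE \<omega> in M. (\<lambda>n. (s n \<omega> - m n) / h n) \<longlonglongrightarrow> 0"
  proof eventually_elim
    case (elim \<omega>)
    show ?case
    proof (rule deviation_negligible_if_negligible_along_squares[OF _ _ incr inf step h0])
      show "mono (\<lambda>n. s n \<omega>)"
        unfolding s_def by (intro monoI sum_mono2) auto
      show "mono m"
        unfolding m_def by (intro monoI sum_mono2) auto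
    qed (use elim in \<open>simp_all add: N_def\<close>)
  qed
  then show ?thesis
    by (simp add: s_def m_def h_def)
qed

section \<open>Counting the elements of a URI-set\<close>

lemma harm_over_ln_tendsto: "(\<lambda>n. harm n / ln (real n)) \<longlonglongrightarrow> 1"
proof -
  have "(\<lambda>n. (harm n - ln (real n)) * inverse (ln (real n)) + 1) \<longlonglongrightarrow> euler_mascheroni * 0 + 1"
    by (intro tendsto_intros euler_mascheroni_LIMSEQ) real_asymp
  moreover have "eventually (\<lambda>n. (harm n - ln (real n)) * inverse (ln (real n)) + 1
      = harm n / ln (real n)) sequentially"
    using eventually_gt_at_top[of 1] by eventually_elim (simp add: field_simps)
  ultimately show ?thesis
    by (simp add: tendsto_cong)
qed

context uri_set
begin

lemma AE_count_deviation:
  assumes "A \<subseteq> {1..}"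
  shows "AE \<omega> in M. (\<lambda>n. ((\<Sum>j=1..n. indicat_real A j * indicat_real (E \<omega>) j)
           - (\<Sum>j=1..n. indicat_real A j / real j)) / ln (real n)) \<longlonglongrightarrow> 0"
proof -
  define B where "B n = {\<omega> \<in> space M. n \<in> E \<omega>}" for n
  have B_prob: "prob (B j) = 1 / real j" if "1 \<le> j" for j
    using prob_mem[OF that] by (simp add: B_def)
  have total: "(\<Sum>j\<in>{1..} \<inter> {..n}. prob (B j)) = harm n" for n
    unfolding harm_def by (intro sum.cong) (auto simp: B_prob inverse_eq_divide)
  have restrict: "(\<Sum>j=1..n. indicat_real A j * f j) = (\<Sum>j\<in>A \<inter> {..n}. f j)" for f :: "nat \<Rightarrow> real" and n
  proof -
    have "A \<inter> {..n} = {1..n} \<inter> A"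
      using assms by auto
    then show ?thesis
      by (simp add: sum.inter_restrict indicator_def if_distrib cong: if_cong)
  qed
  have "AE \<omega> in M. (\<lambda>n. ((\<Sum>j\<in>A \<inter> {..n}. indicat_real (B j) \<omega>) - (\<Sum>j\<in>A \<inter> {..n}. prob (B j)))
           / (\<Sum>j\<in>{1..} \<inter> {..n}. prob (B j))) \<longlonglongrightarrow> 0"
  proof (rule strong_law_pairwise_indep_events[OF _ _ _ assms])
    show "B i \<in> events" if "i \<in> {1..}" for i
      using indep that by (auto simp: indep_events_def B_def)
    show "prob (B i \<inter> B j) = prob (B i) * prob (B j)" if "i \<in> {1..}" "j \<in> {1..}" "i \<noteq> j" for i j
    proof -
      have "\<forall>J\<subseteq>{1..}. J \<noteq> {} \<longrightarrow> finite J \<longrightarrow> prob (\<Inter>l\<in>J. B l) = (\<Prod>l\<in>J. prob (B l))"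
        using indep unfolding indep_events_def B_def by (rule conjunct2)
      from this[rule_format, of "{i, j}"] that show ?thesis
        by simp
    qed
    show "filterlim (\<lambda>n. \<Sum>j\<in>{1..} \<inter> {..n}. prob (B j)) at_top sequentially"
      unfolding total by (rule harm_at_top)
  qed
  with AE_space show ?thesis
  proof eventually_elim
    case (elim \<omega>)
    have "(\<Sum>j=1..n. indicat_real A j * indicat_real (E \<omega>) j) = (\<Sum>j\<in>A \<inter> {..n}. indicat_real (B j) \<omega>)" for n
      unfolding restrict using elim(1) by (intro sum.cong) (simp_all add: B_def indicator_def)
    moreover have "(\<Sum>j=1..n. indicat_real A j / real j) = (\<Sum>j\<in>A \<inter> {..n}. prob (B j))" for n
    proof -
      have "(\<Sum>j=1..n. indicat_real A j / real j) = (\<Sum>j=1..n. indicat_real A j * prob (B j))"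
        by (intro sum.cong) (simp_all add: B_prob)
      then show ?thesis
        by (simp only: restrict)
    qed
    ultimately have "(\<lambda>n. ((\<Sum>j=1..n. indicat_real A j * indicat_real (E \<omega>) j)
           - (\<Sum>j=1..n. indicat_real A j / real j)) / harm n) \<longlonglongrightarrow> 0"
      using elim(2) by (simp only: total)
    from tendsto_mult[OF this harm_over_ln_tendsto]
    have "(\<lambda>n. ((\<Sum>j=1..n. indicat_real A j * indicat_real (E \<omega>) j)
           - (\<Sum>j=1..n. indicat_real A j / real j)) / harm n * (harm n / ln (real n))) \<longlonglongrightarrow> 0"
      by simp
    moreover have "eventually (\<lambda>n. ((\<Sum>j=1..n. indicat_real A j * indicat_real (E \<omega>) j)
           - (\<Sum>j=1..n. indicat_real A j / real j)) / harm n * (harm n / ln (real n))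
         = ((\<Sum>j=1..n. indicat_real A j * indicat_real (E \<omega>) j)
           - (\<Sum>j=1..n. indicat_real A j / real j)) / ln (real n)) sequentially"
      using eventually_gt_at_top[of 0]
    proof eventually_elim
      case (elim n)
      then have "harm n \<noteq> (0 :: real)"
        using harm_pos[of n] by (metis less_irrefl)
      then show ?case
        by simp
    qed
    ultimately show ?case
      by (rule Lim_transform_eventually)
  qed
qed

lemma AE_card_over_ln_tendsto:
  "AE \<omega> in M. (\<lambda>n. real (card (E \<omega> \<inter> {1..n})) / ln (real n)) \<longlonglongrightarrow> 1"
  using AE_count_deviation[OF order_refl]
proof eventually_elim
  case (elim \<omega>)
  have "(\<Sum>j=1..n. indicat_real {1..} j * indicat_real (E \<omega>) j) = real (card (E \<omega> \<inter> {1..n}))" for n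
  proof -
    have "(\<Sum>j=1..n. indicat_real {1..} j * indicat_real (E \<omega>) j) = (\<Sum>j=1..n. indicat_real (E \<omega>) j)"
      by (intro sum.cong) auto
    then show ?thesis
      by (simp add: indicator_def Int_commute)
  qed
  moreover have "(\<Sum>j=1..n. indicat_real {1..} j / real j) = harm n" for n
    unfolding harm_def by (intro sum.cong) (auto simp: inverse_eq_divide)
  ultimately have "(\<lambda>n. (real (card (E \<omega> \<inter> {1..n})) - harm n) / ln (real n)) \<longlonglongrightarrow> 0"
    using elim by simp
  from tendsto_add[OF this harm_over_ln_tendsto] show ?case
    by (simp add: diff_divide_distrib)
qed

text \<open>
  With \<open>c\<close> the number of elements of \<open>E\<close> up to \<open>n\<close>, \<open>S\<close> the number of those in \<open>A\<close>, and \<open>m\<close> the mean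
  of \<open>S\<close>, the difference equals \<open>((S - m) / ln n) (ln n / c) + (m / ln n) (ln n / c - 1)\<close>. Here
  \<open>m / ln n\<close> is bounded because \<open>m\<close> is at most the harmonic number.
\<close>

lemma AE_proportion_minus_log_average:
  assumes "A \<subseteq> {1..}"
  shows "AE \<omega> in M. (\<lambda>n. 1 / real (card (E \<omega> \<inter> {1..n}))
                  * (\<Sum>j=1..n. indicat_real A j * indicat_real (E \<omega>) j)
                - 1 / ln (real n) * (\<Sum>j=1..n. indicat_real A j / real j)) \<longlonglongrightarrow> 0"
  using AE_count_deviation[OF assms] AE_card_over_ln_tendsto
proof eventually_elim
  case (elim \<omega>)
  define c where "c n = real (card (E \<omega> \<inter> {1..n}))" for n
  define s where "s n = (\<Sum>j=1..n. indicat_real A j * indicat_real (E \<omega>) j)" for n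
  define m where "m n = (\<Sum>j=1..n. indicat_real A j / real j)" for n
  have dev: "(\<lambda>n. (s n - m n) / ln (real n)) \<longlonglongrightarrow> 0" and c: "(\<lambda>n. c n / ln (real n)) \<longlonglongrightarrow> 1"
    using elim by (simp_all add: s_def m_def c_def)
  have ratio: "(\<lambda>n. inverse (c n / ln (real n))) \<longlonglongrightarrow> 1"
    using tendsto_inverse[OF c] by simp
  have m_bounds: "0 \<le> m n" "m n \<le> harm n" for n
  proof -
    show "0 \<le> m n"
      unfolding m_def by (intro sum_nonneg) simp
    show "m n \<le> harm n"
      unfolding m_def harm_def by (intro sum_mono) (auto simp: indicator_def inverse_eq_divide)
  qed
  have "(\<lambda>n. m n / ln (real n) * (inverse (c n / ln (real n)) - 1)) \<longlonglongrightarrow> 0"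
  proof (rule Lim_null_comparison)
    show "eventually (\<lambda>n. norm (m n / ln (real n) * (inverse (c n / ln (real n)) - 1))
        \<le> harm n / ln (real n) * \<bar>inverse (c n / ln (real n)) - 1\<bar>) sequentially"
      using eventually_gt_at_top[of 1]
    proof eventually_elim
      case (elim n)
      then have "\<bar>m n / ln (real n)\<bar> \<le> harm n / ln (real n)"
        using m_bounds[of n] by (simp add: divide_right_mono)
      then show ?case
        by (simp only: real_norm_def abs_mult mult_right_mono abs_ge_zero)
    qed
    have "(\<lambda>n. harm n / ln (real n) * \<bar>inverse (c n / ln (real n)) - 1\<bar>) \<longlonglongrightarrow> 1 * \<bar>1 - 1\<bar>"
      by (intro tendsto_intros harm_over_ln_tendsto ratio)
    then show "(\<lambda>n. harm n / ln (real n) * \<bar>inverse (c n / ln (real n)) - 1\<bar>) \<longlonglongrightarrow> 0"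
      by simp
  qed
  from tendsto_add[OF tendsto_mult[OF dev ratio] this]
  have "(\<lambda>n. (s n - m n) / ln (real n) * inverse (c n / ln (real n))
      + m n / ln (real n) * (inverse (c n / ln (real n)) - 1)) \<longlonglongrightarrow> 0"
    by simp
  moreover have "eventually (\<lambda>n. (s n - m n) / ln (real n) * inverse (c n / ln (real n))
      + m n / ln (real n) * (inverse (c n / ln (real n)) - 1)
      = 1 / c n * s n - 1 / ln (real n) * m n) sequentially"
    using eventually_gt_at_top[of 1]
  proof eventually_elim
    case (elim n)
    then show ?case
      by (cases "c n = 0") (simp_all add: field_simps)
  qed
  ultimately show ?case
    unfolding c_def s_def m_def by (rule Lim_transform_eventually)
qed

end

section \<open>URI-density and log-density\<close>

text \<open>
  As \<open>enumerate S\<close> is increasing, the indices of the elements up to \<open>n\<close> form a down-closed set of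
  naturals, which is determined by its cardinality.
\<close>

lemma image_enumerate_lessThan_card:
  fixes S :: "nat set"
  assumes "infinite S"
  shows "enumerate S ` {..<card (S \<inter> {..n})} = S \<inter> {..n}"
proof -
  let ?K = "{k. enumerate S k \<le> n}"
  have img: "enumerate S ` ?K = S \<inter> {..n}"
    using enumerate_in_set[OF assms] enumerate_Ex[OF assms] by fastforce
  have inj: "inj_on (enumerate S) ?K"
    using inj_enumerate[OF assms] inj_on_subset by blast
  have fin: "finite ?K"
    using img inj finite_imageD[of "enumerate S" ?K] by simp
  have down: "k \<in> ?K" if "l \<in> ?K" "k \<le> l" for k l
    using that enumerate_mono_le_iff[OF assms] order_trans by blast
  have "?K = {..<card ?K}"
  proof (rule card_seteq[symmetric, OF fin])
    show "{..<card ?K} \<subseteq> ?K"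
    proof (rule ccontr)
      assume "\<not> {..<card ?K} \<subseteq> ?K"
      then obtain k where k: "k < card ?K" "k \<notin> ?K"
        by blast
      then have "?K \<subseteq> {..<k}"
        using down by (meson lessThan_iff not_le subsetI)
      then show False
        using card_mono[of "{..<k}" ?K] k(1) by simp
    qed
  qed simp
  moreover have "card ?K = card (S \<inter> {..n})"
    using card_image[OF inj] img by simp
  ultimately show ?thesis
    using img by simp
qed

lemma sum_ordered_element:
  fixes S :: "nat set" and f :: "nat \<Rightarrow> real"
  assumes "infinite S"
  shows "(\<Sum>k=1..card (S \<inter> {..n}). f (ordered_element S k)) = (\<Sum>j\<in>S \<inter> {..n}. f j)"
proof -
  have "(\<Sum>k=1..c. f (ordered_element S k)) = (\<Sum>k<c. f (enumerate S k))" for c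
    by (rule sum.reindex_bij_witness[of _ Suc "\<lambda>k. k - 1"]) (auto simp: ordered_element_def)
  also have "(\<Sum>k<card (S \<inter> {..n}). f (enumerate S k)) = sum f (enumerate S ` {..<card (S \<inter> {..n})})"
    using inj_enumerate[OF assms] by (subst sum.reindex) (auto intro: inj_on_subset)
  finally show ?thesis
    by (simp add: image_enumerate_lessThan_card[OF assms])
qed

lemma card_up_to_at_top:
  fixes S :: "nat set"
  assumes "infinite S"
  shows "filterlim (\<lambda>n. card (S \<inter> {..n})) at_top sequentially"
proof (unfold filterlim_at_top, intro allI)
  fix Z
  obtain T where T: "T \<subseteq> S" "finite T" "card T = Z"
    using infinite_arbitrarily_large[OF assms] by blast
  obtain b where b: "T \<subseteq> {..b}"
    using T(2) finite_nat_iff_bounded_le by blast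
  have "Z \<le> card (S \<inter> {..n})" if "b \<le> n" for n
    using T b that by (subst T(3)[symmetric], intro card_mono) auto
  then show "eventually (\<lambda>n. Z \<le> card (S \<inter> {..n})) sequentially"
    using eventually_sequentially by blast
qed

lemma card_up_to_enumerate:
  fixes S :: "nat set"
  assumes "infinite S"
  shows "card (S \<inter> {..enumerate S k}) = Suc k"
proof -
  have "S \<inter> {..enumerate S k} = enumerate S ` {..k}"
    using enumerate_in_set[OF assms] enumerate_Ex[OF assms] assms by fastforce
  then show ?thesis
    using inj_enumerate[OF assms] by (simp add: card_image inj_on_subset)
qed

text \<open>
  The counting function of \<open>S\<close> tends to infinity, which gives the direction from left to right, and at
  the \<open>k\<close>-th element of \<open>S\<close> it equals \<open>k\<close>, which gives the converse.
\<close>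

lemma LIMSEQ_card_up_to_iff:
  fixes S :: "nat set" and R :: "nat \<Rightarrow> real"
  assumes "infinite S"
  shows "R \<longlonglongrightarrow> a \<longleftrightarrow> (\<lambda>n. R (card (S \<inter> {..n}))) \<longlonglongrightarrow> a"
proof
  assume "R \<longlonglongrightarrow> a"
  then show "(\<lambda>n. R (card (S \<inter> {..n}))) \<longlonglongrightarrow> a"
    using card_up_to_at_top[OF assms] by (rule filterlim_compose)
next
  assume *: "(\<lambda>n. R (card (S \<inter> {..n}))) \<longlonglongrightarrow> a"
  have "filterlim (enumerate S) at_top sequentially"
    using assms by (intro filterlim_subseq strict_monoI) simp
  with * have "(\<lambda>k. R (card (S \<inter> {..enumerate S k}))) \<longlonglongrightarrow> a"
    by (rule filterlim_compose)
  then show "R \<longlonglongrightarrow> a"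
    by (simp add: card_up_to_enumerate[OF assms] filterlim_sequentially_Suc)
qed

lemma (in uri_set) AE_infinite: "AE \<omega> in M. infinite (E \<omega>)"
  using AE_card_over_ln_tendsto
proof eventually_elim
  case (elim \<omega>)
  show ?case
  proof
    assume fin: "finite (E \<omega>)"
    have "(\<lambda>n. real (card (E \<omega> \<inter> {1..n})) / ln (real n)) \<longlonglongrightarrow> 0"
    proof (rule Lim_null_comparison)
      show "eventually (\<lambda>n. norm (real (card (E \<omega> \<inter> {1..n})) / ln (real n))
          \<le> real (card (E \<omega>)) / ln (real n)) sequentially"
        using eventually_gt_at_top[of 1]
        by eventually_elim (auto intro!: divide_right_mono card_mono fin)
      show "(\<lambda>n. real (card (E \<omega>)) / ln (real n)) \<longlonglongrightarrow> 0"
        by real_asymp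
    qed
    with elim show False
      using LIMSEQ_unique by fastforce
  qed
qed

text \<open>
  The exceptional null set is the same for all \<open>\<alpha>\<close>: once \<open>E\<close> is infinite and its proportions in
  \<open>A\<close> follow the logarithmic averages of \<open>A\<close>, the equivalence is deterministic.
\<close>

lemma (in uri_set) AE_ordered_average_limit_iff_log_density:
  assumes "A \<subseteq> {1..}"
  shows "AE \<omega> in M. \<forall>\<alpha>. (\<lambda>n. 1 / real n * (\<Sum>k=1..n. indicat_real A (ordered_element (E \<omega>) k)))
           \<longlonglongrightarrow> \<alpha> \<longleftrightarrow> has_log_density A \<alpha>"
  using AE_proportion_minus_log_average[OF assms] AE_infinite AE_space
proof eventually_elim
  case (elim \<omega>)
  define R where "R n = 1 / real n * (\<Sum>k=1..n. indicat_real A (ordered_element (E \<omega>) k))" for n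
  define L where "L n = 1 / ln (real n) * (\<Sum>j=1..n. indicat_real A j / real j)" for n
  have up_to: "E \<omega> \<inter> {1..n} = E \<omega> \<inter> {..n}" for n
    using positive[OF elim(3)] by auto
  have "R (card (E \<omega> \<inter> {..n})) = 1 / real (card (E \<omega> \<inter> {1..n}))
      * (\<Sum>j=1..n. indicat_real A j * indicat_real (E \<omega>) j)" for n
  proof -
    have "(\<Sum>j=1..n. indicat_real A j * indicat_real (E \<omega>) j) = (\<Sum>j\<in>E \<omega> \<inter> {1..n}. indicat_real A j)"
      by (simp add: indicator_def Int_ac)
    then show ?thesis
      unfolding R_def by (simp only: sum_ordered_element[OF elim(2)] up_to)
  qed
  then have diff: "(\<lambda>n. R (card (E \<omega> \<inter> {..n})) - L n) \<longlonglongrightarrow> 0"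
    using elim(1) by (simp add: L_def)
  have "R \<longlonglongrightarrow> \<alpha> \<longleftrightarrow> L \<longlonglongrightarrow> \<alpha>" for \<alpha>
    unfolding LIMSEQ_card_up_to_iff[OF elim(2), of R]
  proof
    assume "(\<lambda>n. R (card (E \<omega> \<inter> {..n}))) \<longlonglongrightarrow> \<alpha>"
    from tendsto_diff[OF this diff] show "L \<longlonglongrightarrow> \<alpha>"
      by simp
  next
    assume "L \<longlonglongrightarrow> \<alpha>"
    from tendsto_add[OF diff this] show "(\<lambda>n. R (card (E \<omega> \<inter> {..n}))) \<longlonglongrightarrow> \<alpha>"
      by simp
  qed
  then show ?case
    by (simp add: R_def[abs_def] L_def[abs_def] has_log_density_def)
qed

theorem theorem3p6:
  fixes M :: "'w measure" and E :: "'w \<Rightarrow> nat set" and A :: "nat set"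
  assumes "uri_set M E"
    and "A \<subseteq> {1..}"
  shows "(AE \<omega> in M.
           (\<lambda>n. 1 / real (card (E \<omega> \<inter> {1..n}))
                  * (\<Sum>j=1..n. indicat_real A j * indicat_real (E \<omega>) j)
                - 1 / ln (real n) * (\<Sum>j=1..n. indicat_real A j / real j)) \<longlonglongrightarrow> 0)
       \<and> (\<forall>\<alpha>::real. has_uri_density M E A \<alpha> \<longleftrightarrow> has_log_density A \<alpha>)"
proof (intro conjI allI)
  interpret uri_set M E
    by (rule assms)
  show "AE \<omega> in M. (\<lambda>n. 1 / real (card (E \<omega> \<inter> {1..n}))
                  * (\<Sum>j=1..n. indicat_real A j * indicat_real (E \<omega>) j)
                - 1 / ln (real n) * (\<Sum>j=1..n. indicat_real A j / real j)) \<longlonglongrightarrow> 0"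
    by (rule AE_proportion_minus_log_average[OF assms(2)])
  fix \<alpha> :: real
  note iff = AE_ordered_average_limit_iff_log_density[OF assms(2)]
  show "has_uri_density M E A \<alpha> \<longleftrightarrow> has_log_density A \<alpha>"
  proof
    assume "has_log_density A \<alpha>"
    with iff show "has_uri_density M E A \<alpha>"
      unfolding has_uri_density_def by (auto elim: eventually_mono)
  next
    assume "has_uri_density M E A \<alpha>"
    with iff have "AE \<omega> in M. has_log_density A \<alpha>"
      unfolding has_uri_density_def by eventually_elim blast
    \<comment> \<open>The property is deterministic and the space is not null, so almost sure validity is validity.\<close>
    then show "has_log_density A \<alpha>"
      by simp
  qed
qed

end
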